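(* Let $\Phi=(\phi_n)$, $\Psi=(\psi_n)$ be sequences in $\mathcal H$ and $m=(m_n)$ a complex scalar sequence, with $m_n\ne 0$, $\phi_n\neq 0$, $\psi_n\neq 0$ for all $n$. Let $M_{m,\Phi,\Psi}$ be invertible on $\mathcal H$. (i) If $\Psi$ (resp. $\Phi$) is a Bessel sequence for $\mathcal H$ with bound $B$, then $m\Phi$ (resp. $m\Psi$) satisfies the lower frame condition for $\mathcal H$ with bound $\dfrac{1}{B\,\|M_{m,\Phi,\Psi}^{-1}\|^2}$. (ii) If $\Psi$ (resp. $\Phi$) and $m\Phi$ (resp. $m\Psi$) are Bessel sequences for $\mathcal H$, then they are frames for $\mathcal H$. (iii) If $\Psi$ (resp. $\Phi$) is a Bessel sequence for $\mathcal H$ and $m\in\ell^\infty$, then $\Phi$ (resp. $\Psi$) satisfies the lower frame condition for $\mathcal H$. (iv) If $\Psi$ and $\Phi$ are Bessel sequences for $\mathcal H$ and $m\in\ell^\infty$, then $\Psi$ and $\Phi$ are frames for $\mathcal H$; $m\Phi$ and $m\Psi$ are also frames for $\mathcal H$.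
   Context: $\mathcal H$ is a separable infinite-dimensional complex Hilbert space, inner product linear in the first argument; all sequences are indexed by $\mathbb N$. The multiplier is $M_{m,\Phi,\Psi}f=\sum_n m_n\langle f,\psi_n\rangle\phi_n$; it is invertible on $\mathcal H$ if the series converges for every $f\in\mathcal H$ and the resulting operator has a bounded two-sided inverse $\mathcal H\to\mathcal H$. Notation: $m\Phi=(m_n\phi_n)$. A sequence $\Phi$ is Bessel for $\mathcal H$ with bound $B>0$ if $\sum|\langle h,\phi_n\rangle|^2\le B\|h\|^2$ for all $h\in\mathcal H$. It satisfies the lower frame condition for $\mathcal H$ with bound $A>0$ if $A\|h\|^2\le\sum|\langle h,\phi_n\rangle|^2$ for all $h\in\mathcal H$ (where the sum may equal $+\infty$). A frame for $\mathcal H$ is a Bessel sequence that satisfies the lower frame condition for some $A>0$. *)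

theory Defs
  imports "HOL-Analysis.Analysis"
begin

class complex_inner = real_normed_vector +
  fixes scaleC :: "complex \<Rightarrow> 'a \<Rightarrow> 'a"  (infixr \<open>*\<^sub>C\<close> 75)
    and cinner :: "'a \<Rightarrow> 'a \<Rightarrow> complex"
  assumes scaleC_add_right: "a *\<^sub>C (x + y) = a *\<^sub>C x + a *\<^sub>C y"
    and scaleC_add_left: "(a + b) *\<^sub>C x = a *\<^sub>C x + b *\<^sub>C x"
    and scaleC_scaleC: "a *\<^sub>C b *\<^sub>C x = (a * b) *\<^sub>C x"
    and scaleR_scaleC: "r *\<^sub>R x = complex_of_real r *\<^sub>C x"
    and cinner_commute: "cinner x y = cnj (cinner y x)"
    and cinner_add_left: "cinner (x + y) z = cinner x z + cinner y z"
    and cinner_scaleC_left: "cinner (a *\<^sub>C x) y = a * cinner x y"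
    and norm_eq_sqrt_cinner: "norm x = sqrt (Re (cinner x x))"

text \<open>Positive definiteness of the inner product is a consequence of the last axiom and the
  norm axioms of \<^class>\<open>real_normed_vector\<close>.\<close>

lemma scaleC_one: "1 *\<^sub>C x = (x :: 'a :: complex_inner)"
  using scaleR_scaleC[of 1 x] by simp

lemma cinner_self: "cinner x x = complex_of_real ((norm x)\<^sup>2)"
proof -
  have "Im (cinner x x) = 0"
    using cinner_commute[of x x] by (simp add: complex_eq_iff)
  moreover have "0 \<le> Re (cinner x x)"
    using norm_ge_zero[of x] by (simp add: norm_eq_sqrt_cinner)
  ultimately show ?thesis
    by (simp add: norm_eq_sqrt_cinner complex_eq_iff)
qed

lemma cinner_self_eq_zero_iff: "cinner x x = 0 \<longleftrightarrow> x = 0"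
  by (simp add: cinner_self)

global_interpretation complex_vec: vector_space "scaleC :: complex \<Rightarrow> 'a \<Rightarrow> 'a :: complex_inner"
  by unfold_locales (simp_all add: scaleC_add_right scaleC_add_left scaleC_scaleC scaleC_one)

class complex_hilbert_space = complex_inner + complete_space

definition infinite_cdim :: "'a :: complex_inner itself \<Rightarrow> bool" where
  "infinite_cdim _ \<longleftrightarrow> \<not> (\<exists>S :: 'a set. finite S \<and> complex_vec.span S = UNIV)"

definition bounded_clinear :: "('a :: complex_inner \<Rightarrow> 'a) \<Rightarrow> bool" where
  "bounded_clinear T \<longleftrightarrow> bounded_linear T \<and> (\<forall>c x. T (c *\<^sub>C x) = c *\<^sub>C T x)"

definition weighted :: "(nat \<Rightarrow> complex) \<Rightarrow> (nat \<Rightarrow> 'a) \<Rightarrow> nat \<Rightarrow> 'a :: complex_inner" where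
  "weighted m \<Phi> n = m n *\<^sub>C \<Phi> n"

definition multiplier_term ::
  "(nat \<Rightarrow> complex) \<Rightarrow> (nat \<Rightarrow> 'a) \<Rightarrow> (nat \<Rightarrow> 'a) \<Rightarrow> 'a \<Rightarrow> nat \<Rightarrow> 'a :: complex_inner" where
  "multiplier_term m \<Phi> \<Psi> f n = (m n * cinner f (\<Psi> n)) *\<^sub>C \<Phi> n"

definition multiplier ::
  "(nat \<Rightarrow> complex) \<Rightarrow> (nat \<Rightarrow> 'a) \<Rightarrow> (nat \<Rightarrow> 'a) \<Rightarrow> 'a \<Rightarrow> 'a :: complex_inner" where
  "multiplier m \<Phi> \<Psi> f = (\<Sum>n. multiplier_term m \<Phi> \<Psi> f n)"

definition invertible_multiplier ::
  "(nat \<Rightarrow> complex) \<Rightarrow> (nat \<Rightarrow> 'a) \<Rightarrow> (nat \<Rightarrow> 'a :: complex_inner) \<Rightarrow> bool" where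
  "invertible_multiplier m \<Phi> \<Psi> \<longleftrightarrow>
     (\<forall>f. summable (multiplier_term m \<Phi> \<Psi> f)) \<and>
     (\<exists>T. bounded_clinear T \<and>
        T \<circ> multiplier m \<Phi> \<Psi> = id \<and> multiplier m \<Phi> \<Psi> \<circ> T = id)"

text \<open>Sums of squares are taken in \<^typ>\<open>ennreal\<close>, so that they may be infinite.\<close>

definition coeff_energy :: "(nat \<Rightarrow> 'a) \<Rightarrow> 'a :: complex_inner \<Rightarrow> ennreal" where
  "coeff_energy \<Phi> h = (\<Sum>n. ennreal ((cmod (cinner h (\<Phi> n)))\<^sup>2))"

definition bessel_with_bound :: "(nat \<Rightarrow> 'a :: complex_inner) \<Rightarrow> real \<Rightarrow> bool" where
  "bessel_with_bound \<Phi> B \<longleftrightarrow> B > 0 \<and> (\<forall>h. coeff_energy \<Phi> h \<le> ennreal (B * (norm h)\<^sup>2))"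

definition bessel :: "(nat \<Rightarrow> 'a :: complex_inner) \<Rightarrow> bool" where
  "bessel \<Phi> \<longleftrightarrow> (\<exists>B. bessel_with_bound \<Phi> B)"

definition lower_frame_with_bound :: "(nat \<Rightarrow> 'a :: complex_inner) \<Rightarrow> real \<Rightarrow> bool" where
  "lower_frame_with_bound \<Phi> A \<longleftrightarrow> A > 0 \<and> (\<forall>h. ennreal (A * (norm h)\<^sup>2) \<le> coeff_energy \<Phi> h)"

definition lower_frame :: "(nat \<Rightarrow> 'a :: complex_inner) \<Rightarrow> bool" where
  "lower_frame \<Phi> \<longleftrightarrow> (\<exists>A. lower_frame_with_bound \<Phi> A)"

definition frame :: "(nat \<Rightarrow> 'a :: complex_inner) \<Rightarrow> bool" where
  "frame \<Phi> \<longleftrightarrow> bessel \<Phi> \<and> lower_frame \<Phi>"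

end

theory Submission
  imports Defs
begin

text \<open>
  Everything rests on one Cauchy--Schwarz estimate: splitting the symbol as \<open>|m| = |u| |v|\<close> gives
  \<open>|\<langle>M f, h\<rangle>|\<^sup>2 \<le> E(u\<Psi>, f) E(v\<Phi>, h)\<close>, where \<open>E\<close> is the (possibly infinite) coefficient energy.
  With \<open>f = M\<^sup>-\<^sup>1 h\<close>, a Bessel bound for \<open>u\<Psi>\<close> bounds \<open>E(v\<Phi>, h)\<close> from below; with \<open>h = M f\<close>, a Bessel
  bound for \<open>v\<Phi>\<close> bounds \<open>E(u\<Psi>, f)\<close> from below. All parts come from the choices
  \<open>(u, v) = (1, m)\<close> and \<open>(u, v) = (m, 1)\<close>.
\<close>

section \<open>Inner product: the second argument, Cauchy--Schwarz, continuity\<close>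

lemma cinner_add_right: "cinner x (y + z) = cinner x y + cinner x z"
  by (metis cinner_add_left cinner_commute complex_cnj_add)

lemma cinner_scaleC_right: "cinner x (a *\<^sub>C y) = cnj a * cinner x y"
  by (metis cinner_commute cinner_scaleC_left complex_cnj_mult)

lemma cinner_Cauchy_Schwarz: "cmod (cinner x y) \<le> norm x * norm y"
proof (cases "y = 0")
  case True
  then have "cinner x y = 0"
    using cinner_add_right[of x 0 0] by simp
  then show ?thesis by simp
next
  case False
  \<comment> \<open>\<open>c *\<^sub>C y\<close> is the orthogonal projection of \<open>x\<close>
    onto the line through \<open>y\<close>. Pythagoras gives the norm of \<open>x\<close>, and
    dropping the residual \<open>z\<close> leaves the inequality.\<close>
  define c where "c = cinner x y / complex_of_real ((norm y)\<^sup>2)"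
  define z where "z = x - c *\<^sub>C y"
  have x: "x = z + c *\<^sub>C y" by (simp add: z_def)
  have xy: "cinner x y = c * complex_of_real ((norm y)\<^sup>2)"
    using False by (simp add: c_def)
  have zy: "cinner z y = 0"
    using xy x by (simp add: cinner_add_left cinner_scaleC_left cinner_self)
  then have "cinner y z = 0"
    using cinner_commute[of y z] by simp
  then have "cinner x x = cinner z z + c * cnj c * cinner y y"
    using zy unfolding x
    by (simp add: cinner_add_left cinner_add_right cinner_scaleC_left cinner_scaleC_right)
  also have "\<dots> = complex_of_real ((norm z)\<^sup>2 + (cmod c)\<^sup>2 * (norm y)\<^sup>2)"
    by (simp add: cinner_self complex_norm_square[symmetric])
  finally have "(norm x)\<^sup>2 = (norm z)\<^sup>2 + (cmod c)\<^sup>2 * (norm y)\<^sup>2"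
    unfolding cinner_self of_real_eq_iff .
  then have "(cmod c * norm y)\<^sup>2 \<le> (norm x)\<^sup>2"
    by (simp add: power_mult_distrib)
  then have "cmod c * norm y \<le> norm x"
    by (rule power2_le_imp_le) simp
  then have "cmod c * norm y * norm y \<le> norm x * norm y"
    by (rule mult_right_mono) simp
  then show ?thesis
    by (simp add: xy norm_mult norm_power power2_eq_square mult.assoc)
qed

lemma bounded_linear_cinner_left: "bounded_linear (\<lambda>x. cinner x y)"
proof (rule bounded_linear_intro[where K = "norm y"])
  show "cinner (r *\<^sub>R x) y = r *\<^sub>R cinner x y" for r x
    by (simp add: scaleR_scaleC cinner_scaleC_left scaleR_conv_of_real)
qed (simp_all add: cinner_add_left cinner_Cauchy_Schwarz)

section \<open>Weighted sequences and their energies; the key estimate\<close>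

lemma cmod_cinner_weighted: "cmod (cinner h (weighted m \<Phi> n)) = cmod (m n) * cmod (cinner h (\<Phi> n))"
  by (simp add: weighted_def cinner_scaleC_right norm_mult)

lemma weighted_one: "weighted (\<lambda>_. 1) \<Phi> = \<Phi>"
  by (simp add: weighted_def scaleC_one fun_eq_iff)

lemma partial_energy_le:
  "ennreal (\<Sum>n<N. (cmod (cinner h (\<Phi> n)))\<^sup>2) \<le> coeff_energy \<Phi> h"
proof -
  have "ennreal (\<Sum>n<N. (cmod (cinner h (\<Phi> n)))\<^sup>2) = (\<Sum>n<N. ennreal ((cmod (cinner h (\<Phi> n)))\<^sup>2))"
    by (simp add: sum_ennreal)
  also have "\<dots> \<le> coeff_energy \<Phi> h"
    unfolding coeff_energy_def by (rule sum_le_suminf) auto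
  finally show ?thesis .
qed

text \<open>Holds termwise, also for infinite energy. It carries Bessel bounds from
  \<open>\<Phi>\<close> to \<open>weighted m \<Phi>\<close> and lower bounds in the opposite
  direction.\<close>

lemma coeff_energy_weighted_le:
  assumes "\<And>n. cmod (m n) \<le> C"
  shows "coeff_energy (weighted m \<Phi>) h \<le> ennreal (C\<^sup>2) * coeff_energy \<Phi> h"
proof -
  have "ennreal ((cmod (cinner h (weighted m \<Phi> n)))\<^sup>2)
      \<le> ennreal (C\<^sup>2) * ennreal ((cmod (cinner h (\<Phi> n)))\<^sup>2)" for n
    unfolding cmod_cinner_weighted power_mult_distrib
    by (subst ennreal_mult[symmetric])
      (auto intro!: ennreal_leI mult_right_mono power_mono assms)
  then show ?thesis
    unfolding coeff_energy_def ennreal_suminf_cmult[symmetric]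
    by (intro suminf_le) auto
qed

text \<open>Finite Cauchy--Schwarz bounds every partial sum of the series by the same product of
  full energies; continuity of the inner product passes this to the limit. Since the product lives
  in \<open>ennreal\<close>, either energy may be infinite.\<close>

lemma cinner_multiplier_le:
  assumes "summable (multiplier_term m \<Phi> \<Psi> f)"
    and uv: "\<And>n. cmod (m n) = cmod (u n) * cmod (v n)"
  shows "ennreal ((cmod (cinner (multiplier m \<Phi> \<Psi> f) h))\<^sup>2)
    \<le> coeff_energy (weighted u \<Psi>) f * coeff_energy (weighted v \<Phi>) h"
proof (rule LIMSEQ_le_const2)
  let ?S = "\<lambda>N. \<Sum>n<N. multiplier_term m \<Phi> \<Psi> f n"
  have "(\<lambda>N. cinner (?S N) h) \<longlonglongrightarrow> cinner (multiplier m \<Phi> \<Psi> f) h"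
    unfolding multiplier_def
    by (intro bounded_linear.tendsto[OF bounded_linear_cinner_left] summable_LIMSEQ assms(1))
  then show "(\<lambda>N. ennreal ((cmod (cinner (?S N) h))\<^sup>2))
      \<longlonglongrightarrow> ennreal ((cmod (cinner (multiplier m \<Phi> \<Psi> f) h))\<^sup>2)"
    by (intro tendsto_intros)
  have "ennreal ((cmod (cinner (?S N) h))\<^sup>2)
      \<le> coeff_energy (weighted u \<Psi>) f * coeff_energy (weighted v \<Phi>) h" for N
  proof -
    let ?a = "\<lambda>n. cmod (cinner f (weighted u \<Psi> n))" and ?b = "\<lambda>n. cmod (cinner h (weighted v \<Phi> n))"
    \<comment> \<open>Only moduli enter, so neither the phases of \<open>u\<close> and
      \<open>v\<close> nor the conjugation in the second argument matters.\<close>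
    have termN: "cmod (cinner (multiplier_term m \<Phi> \<Psi> f n) h) = ?a n * ?b n" for n
    proof -
      have "cmod (cinner (\<Phi> n) h) = cmod (cinner h (\<Phi> n))"
        by (metis cinner_commute complex_mod_cnj)
      then show ?thesis
        by (simp add: multiplier_term_def cinner_scaleC_left norm_mult cmod_cinner_weighted uv)
    qed
    have "cinner (?S N) h = (\<Sum>n<N. cinner (multiplier_term m \<Phi> \<Psi> f n) h)"
      using bounded_linear_cinner_left bounded_linear.linear linear_sum by blast
    then have "cmod (cinner (?S N) h) \<le> (\<Sum>n<N. ?a n * ?b n)"
      using norm_sum[of "\<lambda>n. cinner (multiplier_term m \<Phi> \<Psi> f n) h" "{..<N}"] by (simp add: termN)
    then have "(cmod (cinner (?S N) h))\<^sup>2 \<le> (\<Sum>n<N. ?a n * ?b n)\<^sup>2"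
      by (rule power_mono) simp
    also have "\<dots> \<le> (\<Sum>n<N. (?a n)\<^sup>2) * (\<Sum>n<N. (?b n)\<^sup>2)"
      by (rule Cauchy_Schwarz_ineq_sum)
    finally have "ennreal ((cmod (cinner (?S N) h))\<^sup>2)
        \<le> ennreal (\<Sum>n<N. (?a n)\<^sup>2) * ennreal (\<Sum>n<N. (?b n)\<^sup>2)"
      by (simp add: ennreal_mult[symmetric] sum_nonneg ennreal_leI)
    also have "\<dots> \<le> coeff_energy (weighted u \<Psi>) f * coeff_energy (weighted v \<Phi>) h"
      by (intro mult_mono partial_energy_le) auto
    finally show ?thesis .
  qed
  then show "\<exists>N0. \<forall>N\<ge>N0. ennreal ((cmod (cinner (?S N) h))\<^sup>2)
      \<le> coeff_energy (weighted u \<Psi>) f * coeff_energy (weighted v \<Phi>) h"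
    by blast
qed

text \<open>Used with \<open>s = norm h\<close>: the fourth power is the squared modulus of
  \<open>cinner h h\<close>, and dividing by \<open>K * s\<^sup>2\<close> leaves a lower frame
  inequality. For \<open>s = 0\<close> or infinite \<open>E\<close> the claim is trivial.\<close>

lemma ennreal_cancel_square:
  assumes "K > 0" and le: "ennreal ((s\<^sup>2)\<^sup>2) \<le> ennreal (K * s\<^sup>2) * E"
  shows "ennreal (1 / K * s\<^sup>2) \<le> E"
proof (cases E)
  case (real e)
  show ?thesis
  proof (cases "s = 0")
    case False
    have "(s\<^sup>2)\<^sup>2 \<le> K * s\<^sup>2 * e"
      using le real \<open>K > 0\<close> by (simp add: ennreal_mult[symmetric])
    then have "s\<^sup>2 * s\<^sup>2 \<le> s\<^sup>2 * (K * e)"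
      by (simp only: power2_eq_square ac_simps)
    then have "s\<^sup>2 \<le> K * e"
      by (rule mult_left_le_imp_le) (use False in simp)
    then show ?thesis
      using real \<open>K > 0\<close> by (simp add: field_simps ennreal_leI)
  qed simp
qed simp

section \<open>The inverse operator and the two lower frame bounds\<close>

text \<open>Invertibility only asserts that some bounded inverse exists; uniqueness of two-sided
  inverses identifies it with \<open>inv\<close>, whose norm appears in the bounds.\<close>

lemma invertible_multiplier_inv:
  assumes "invertible_multiplier m \<Phi> \<Psi>"
  shows "bounded_linear (inv (multiplier m \<Phi> \<Psi>))" "bij (multiplier m \<Phi> \<Psi>)"
proof -
  obtain T where T: "bounded_clinear T" "T \<circ> multiplier m \<Phi> \<Psi> = id" "multiplier m \<Phi> \<Psi> \<circ> T = id"
    using assms unfolding invertible_multiplier_def by blast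
  then have "inv (multiplier m \<Phi> \<Psi>) = T"
    by (metis inv_unique_comp)
  then show "bounded_linear (inv (multiplier m \<Phi> \<Psi>))"
    using T(1) by (simp add: bounded_clinear_def)
  show "bij (multiplier m \<Phi> \<Psi>)"
    using T(2,3) by (rule o_bij)
qed

text \<open>An injective linear map does not annihilate \<open>x\<close>. Positivity matters because
  the frame bounds divide by the square of this norm.\<close>

lemma onorm_inv_multiplier_pos:
  fixes \<Phi> \<Psi> :: "nat \<Rightarrow> 'a :: complex_inner"
  assumes "invertible_multiplier m \<Phi> \<Psi>" and "x \<noteq> (0 :: 'a)"
  shows "onorm (inv (multiplier m \<Phi> \<Psi>)) > 0"
proof -
  note inv = invertible_multiplier_inv[OF assms(1)]
  have "inv (multiplier m \<Phi> \<Psi>) x \<noteq> inv (multiplier m \<Phi> \<Psi>) 0"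
    using assms(2) bij_imp_bij_inv[OF inv(2)] by (meson bij_is_inj injD)
  then show ?thesis
    using inv(1) by (metis bounded_linear.axioms(1) linear_0 onorm_pos_lt)
qed

lemma lower_frame_if_bessel_right:
  fixes \<Phi> \<Psi> :: "nat \<Rightarrow> 'a :: complex_inner"
  assumes inv: "invertible_multiplier m \<Phi> \<Psi>" and "x \<noteq> (0 :: 'a)"
    and uv: "\<And>n. cmod (m n) = cmod (u n) * cmod (v n)"
    and B: "bessel_with_bound (weighted u \<Psi>) B"
  shows "lower_frame_with_bound (weighted v \<Phi>) (1 / (B * (onorm (inv (multiplier m \<Phi> \<Psi>)))\<^sup>2))"
proof -
  let ?M = "multiplier m \<Phi> \<Psi>"
  let ?K = "B * (onorm (inv ?M))\<^sup>2"
  have "B > 0" using B by (simp add: bessel_with_bound_def)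
  then have K: "?K > 0" using onorm_inv_multiplier_pos[OF inv assms(2)] by simp
  have "ennreal (1 / ?K * (norm h)\<^sup>2) \<le> coeff_energy (weighted v \<Phi>) h" for h
  proof (rule ennreal_cancel_square[OF K])
    \<comment> \<open>The Bessel bound at \<open>?f\<close> costs \<open>B\<close>, and replacing
      \<open>norm ?f\<close> by \<open>norm h\<close> costs the squared norm of the inverse;
      together they form \<open>?K\<close>.\<close>
    let ?f = "inv ?M h"
    have "?M ?f = h"
      using invertible_multiplier_inv(2)[OF inv] by (simp add: bij_is_surj surj_f_inv_f)
    then have "ennreal (((norm h)\<^sup>2)\<^sup>2)
        \<le> coeff_energy (weighted u \<Psi>) ?f * coeff_energy (weighted v \<Phi>) h"
      using cinner_multiplier_le[of m \<Phi> \<Psi> ?f u v h] inv uv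
      by (simp add: invertible_multiplier_def cinner_self norm_power)
    also have "\<dots> \<le> ennreal (?K * (norm h)\<^sup>2) * coeff_energy (weighted v \<Phi>) h"
    proof (rule mult_right_mono)
      have "coeff_energy (weighted u \<Psi>) ?f \<le> ennreal (B * (norm ?f)\<^sup>2)"
        using B by (simp add: bessel_with_bound_def)
      also have "\<dots> \<le> ennreal (B * (onorm (inv ?M) * norm h)\<^sup>2)"
        using \<open>B > 0\<close> onorm[OF invertible_multiplier_inv(1)[OF inv]]
        by (intro ennreal_leI mult_left_mono power_mono) auto
      finally show "coeff_energy (weighted u \<Psi>) ?f \<le> ennreal (?K * (norm h)\<^sup>2)"
        by (simp add: power_mult_distrib mult.assoc)
    qed simp
    finally show "ennreal (((norm h)\<^sup>2)\<^sup>2)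
        \<le> ennreal (?K * (norm h)\<^sup>2) * coeff_energy (weighted v \<Phi>) h" .
  qed
  with K show ?thesis by (simp add: lower_frame_with_bound_def)
qed

text \<open>Here the inverse enters only through the fact that the multiplier is bounded below. This
  avoids the adjoint multiplier, for whose series only weak convergence is immediate.\<close>

lemma lower_frame_if_bessel_left:
  fixes \<Phi> \<Psi> :: "nat \<Rightarrow> 'a :: complex_inner"
  assumes inv: "invertible_multiplier m \<Phi> \<Psi>" and "x \<noteq> (0 :: 'a)"
    and uv: "\<And>n. cmod (m n) = cmod (u n) * cmod (v n)"
    and B: "bessel_with_bound (weighted v \<Phi>) B"
  shows "lower_frame_with_bound (weighted u \<Psi>) (1 / (B * (onorm (inv (multiplier m \<Phi> \<Psi>)))\<^sup>2))"
proof -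
  let ?M = "multiplier m \<Phi> \<Psi>"
  let ?K = "B * (onorm (inv ?M))\<^sup>2"
  have "B > 0" using B by (simp add: bessel_with_bound_def)
  have T: "onorm (inv ?M) > 0" using onorm_inv_multiplier_pos[OF inv assms(2)] .
  have "ennreal (1 / ?K * (norm f)\<^sup>2) \<le> coeff_energy (weighted u \<Psi>) f" for f
  proof -
    \<comment> \<open>Apply the operator norm bound to \<open>f = inv ?M (?M f)\<close>.\<close>
    have "norm f \<le> onorm (inv ?M) * norm (?M f)"
      using onorm[OF invertible_multiplier_inv(1)[OF inv], of "?M f"]
        invertible_multiplier_inv(2)[OF inv] by (simp add: bij_is_inj)
    then have "(norm f)\<^sup>2 \<le> (onorm (inv ?M))\<^sup>2 * (norm (?M f))\<^sup>2"
      by (metis norm_ge_zero power_mono power_mult_distrib)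
    \<comment> \<open>Passing from \<open>f\<close> to \<open>?M f\<close> absorbs the norm of the
      inverse, so the cancellation that follows involves only the constant \<open>B\<close>.\<close>
    then have "ennreal (1 / ?K * (norm f)\<^sup>2) \<le> ennreal (1 / B * (norm (?M f))\<^sup>2)"
      using \<open>B > 0\<close> T by (intro ennreal_leI) (simp add: field_simps)
    also have "\<dots> \<le> coeff_energy (weighted u \<Psi>) f"
    proof (rule ennreal_cancel_square[OF \<open>B > 0\<close>])
      have "ennreal (((norm (?M f))\<^sup>2)\<^sup>2)
          \<le> coeff_energy (weighted u \<Psi>) f * coeff_energy (weighted v \<Phi>) (?M f)"
        using cinner_multiplier_le[of m \<Phi> \<Psi> f u v "?M f"] inv uv
        by (simp add: invertible_multiplier_def cinner_self norm_power)
      also have "\<dots> \<le> coeff_energy (weighted u \<Psi>) f * ennreal (B * (norm (?M f))\<^sup>2)"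
        using B by (intro mult_left_mono) (simp_all add: bessel_with_bound_def)
      finally show "ennreal (((norm (?M f))\<^sup>2)\<^sup>2)
          \<le> ennreal (B * (norm (?M f))\<^sup>2) * coeff_energy (weighted u \<Psi>) f"
        by (simp only: mult.commute)
    qed
    finally show ?thesis .
  qed
  with \<open>B > 0\<close> T show ?thesis by (simp add: lower_frame_with_bound_def)
qed

section \<open>Bounded symbols\<close>

lemma bounded_range_cmodE:
  assumes "bounded (range (m :: nat \<Rightarrow> complex))"
  obtains C where "C > 0" "\<And>n. cmod (m n) \<le> C"
  using assms unfolding bounded_pos by auto

lemma bessel_weighted:
  assumes "bessel \<Phi>" "bounded (range m)"
  shows "bessel (weighted m \<Phi>)"
proof -
  obtain B where B: "B > 0" "\<And>h. coeff_energy \<Phi> h \<le> ennreal (B * (norm h)\<^sup>2)"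
    using assms(1) by (auto simp: bessel_def bessel_with_bound_def)
  obtain C where C: "C > 0" "\<And>n. cmod (m n) \<le> C"
    using assms(2) by (rule bounded_range_cmodE) blast
  have "coeff_energy (weighted m \<Phi>) h \<le> ennreal (C\<^sup>2 * B * (norm h)\<^sup>2)" for h
  proof -
    have "coeff_energy (weighted m \<Phi>) h \<le> ennreal (C\<^sup>2) * coeff_energy \<Phi> h"
      using C(2) by (rule coeff_energy_weighted_le)
    also have "\<dots> \<le> ennreal (C\<^sup>2) * ennreal (B * (norm h)\<^sup>2)"
      using B(2) by (rule mult_left_mono) simp
    finally show ?thesis
      using B(1) by (simp add: ennreal_mult[symmetric] mult.assoc)
  qed
  moreover have "C\<^sup>2 * B > 0" using B(1) C(1) by simp
  ultimately show ?thesis by (auto simp: bessel_def bessel_with_bound_def)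
qed

text \<open>Weighting by \<open>m\<close> raises the energy by at most the factor
  \<open>C\<^sup>2\<close>, so dividing the lower bound by \<open>C\<^sup>2\<close> gives one for
  \<open>\<Phi>\<close>.\<close>

lemma lower_frame_of_weighted:
  assumes "lower_frame (weighted m \<Phi>)" "bounded (range m)"
  shows "lower_frame \<Phi>"
proof -
  obtain A where A: "A > 0" "\<And>h. ennreal (A * (norm h)\<^sup>2) \<le> coeff_energy (weighted m \<Phi>) h"
    using assms(1) by (auto simp: lower_frame_def lower_frame_with_bound_def)
  obtain C where C: "C > 0" "\<And>n. cmod (m n) \<le> C"
    using assms(2) by (rule bounded_range_cmodE) blast
  have "ennreal (A / C\<^sup>2 * (norm h)\<^sup>2) \<le> coeff_energy \<Phi> h" for h
  proof -
    have *: "ennreal (A * (norm h)\<^sup>2) \<le> ennreal (C\<^sup>2) * coeff_energy \<Phi> h"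
      using A(2) coeff_energy_weighted_le[OF C(2)] by (rule order_trans)
    show ?thesis
    proof (cases "coeff_energy \<Phi> h")
      case (real e)
      then have "A * (norm h)\<^sup>2 \<le> C\<^sup>2 * e"
        using * by (simp add: ennreal_mult[symmetric])
      then show ?thesis
        using real C(1) by (simp add: field_simps ennreal_leI)
    qed simp
  qed
  moreover have "A / C\<^sup>2 > 0" using A(1) C(1) by simp
  ultimately show ?thesis by (auto simp: lower_frame_def lower_frame_with_bound_def)
qed

theorem theorem4p3:
  fixes \<Phi> \<Psi> :: "nat \<Rightarrow> 'a :: complex_hilbert_space"
    and m :: "nat \<Rightarrow> complex"
  assumes "separable_space (euclidean :: 'a topology)"
    and "infinite_cdim TYPE('a)"
    and "\<And>n. m n \<noteq> 0" and "\<And>n. \<Phi> n \<noteq> 0" and "\<And>n. \<Psi> n \<noteq> 0"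
    and "invertible_multiplier m \<Phi> \<Psi>"
  shows
    "(\<forall>B. (bessel_with_bound \<Psi> B \<longrightarrow>
             lower_frame_with_bound (weighted m \<Phi>) (1 / (B * (onorm (inv (multiplier m \<Phi> \<Psi>)))\<^sup>2))) \<and>
          (bessel_with_bound \<Phi> B \<longrightarrow>
             lower_frame_with_bound (weighted m \<Psi>) (1 / (B * (onorm (inv (multiplier m \<Phi> \<Psi>)))\<^sup>2)))) \<and>
     ((bessel \<Psi> \<and> bessel (weighted m \<Phi>) \<longrightarrow> frame \<Psi> \<and> frame (weighted m \<Phi>)) \<and>
      (bessel \<Phi> \<and> bessel (weighted m \<Psi>) \<longrightarrow> frame \<Phi> \<and> frame (weighted m \<Psi>))) \<and>
     ((bessel \<Psi> \<and> bounded (range m) \<longrightarrow> lower_frame \<Phi>) \<and>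
      (bessel \<Phi> \<and> bounded (range m) \<longrightarrow> lower_frame \<Psi>)) \<and>
     (bessel \<Psi> \<and> bessel \<Phi> \<and> bounded (range m) \<longrightarrow>
        frame \<Psi> \<and> frame \<Phi> \<and> frame (weighted m \<Phi>) \<and> frame (weighted m \<Psi>))"
proof -
  \<comment> \<open>\<open>\<Phi> 0\<close> serves as the nonzero vector that makes the norm of the
    inverse positive.\<close>
  note inv = assms(6) and nz = assms(4)[of 0]
  let ?K = "\<lambda>B. 1 / (B * (onorm (inv (multiplier m \<Phi> \<Psi>)))\<^sup>2)"
  have i: "lower_frame_with_bound (weighted m \<Phi>) (?K B)" if "bessel_with_bound \<Psi> B" for B
    using lower_frame_if_bessel_right[OF inv nz, of "\<lambda>_. 1" m B] that by (simp add: weighted_one)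
  have i': "lower_frame_with_bound (weighted m \<Psi>) (?K B)" if "bessel_with_bound \<Phi> B" for B
    using lower_frame_if_bessel_left[OF inv nz, of m "\<lambda>_. 1" B] that by (simp add: weighted_one)
  \<comment> \<open>The same two splittings as in \<open>i\<close> and \<open>i'\<close>, now with
    the Bessel assumption on the factor that carries \<open>m\<close>.\<close>
  have j: "lower_frame_with_bound \<Psi> (?K B)" if "bessel_with_bound (weighted m \<Phi>) B" for B
    using lower_frame_if_bessel_left[OF inv nz, of "\<lambda>_. 1" m B] that by (simp add: weighted_one)
  have j': "lower_frame_with_bound \<Phi> (?K B)" if "bessel_with_bound (weighted m \<Psi>) B" for B
    using lower_frame_if_bessel_right[OF inv nz, of m "\<lambda>_. 1" B] that by (simp add: weighted_one)
  have k: "bessel \<Psi> \<Longrightarrow> lower_frame (weighted m \<Phi>)" "bessel \<Phi> \<Longrightarrow> lower_frame (weighted m \<Psi>)"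
    "bessel (weighted m \<Phi>) \<Longrightarrow> lower_frame \<Psi>" "bessel (weighted m \<Psi>) \<Longrightarrow> lower_frame \<Phi>"
    using i i' j j' unfolding bessel_def lower_frame_def by blast+
  \<comment> \<open>In (ii) each Bessel assumption yields the lower bound of the other sequence. For
    (iii), the lower bound from (i) is transferred to the unweighted sequence. In (iv) a bounded
    \<open>m\<close> makes all four sequences Bessel, and \<open>k\<close> then supplies all four
    lower bounds.\<close>
  show ?thesis
    unfolding frame_def
    using i i' k bessel_weighted lower_frame_of_weighted by blast
qed

end
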